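(* Let $f$ be a norm on $\mathbb{R}^n$ and let $\{\theta_\nu\}_{\nu=1}^\infty\subset B_f^1$ be a sequence such that for each $\nu$ the point $0$, regarded as a point of the boundary $\partial B_f^1(\theta_\nu)$, is illuminated from the point $\theta_{\nu+1}$. Then there exists a vector $\alpha=(\alpha_1,\dots,\alpha_n)\in\mathbb{R}^n$ with $1,\alpha_1,\dots,\alpha_n$ linearly independent over $\mathbb{Q}$ such that $$\lim_{\nu\to+\infty}|\Xi_\nu-\theta_\nu|=0,$$ where $\Xi_\nu=\xi_\nu/f(\xi_\nu)$, $\xi_\nu=\alpha p_\nu-a_\nu$ and $(p_\nu,a_\nu)$ is the $\nu$-th $f$-best simultaneous approximation to $\alpha$.
   Context: A norm $f$ here is a continuous function $\mathbb{R}^n\to\mathbb{R}_+$ with $f(x)=0\iff x=0$, $f(-x)=f(x)$, $f(tx)=tf(x)$ for $t\ge0$, and convex unit ball $B_f^1=\{y:f(y)\le1\}$ with $0$ in its interior; $B_f^1(a)=\{y:f(y-a)\le1\}$. For a closed convex set $M\subset\mathbb{R}^n$, a point $b\in\partial M$ and a point $a\notin M$, $b$ is illuminated from $a$ if there is $\lambda>0$ with $b+\lambda(b-a)\in\operatorname{int}M$. For $\alpha\in\mathbb{R}^n$, an $f$-best simultaneous approximation is an integer point $\tau=(p,a_1,\dots,a_n)\in\mathbb{Z}^{n+1}$ with $p\ge1$ such that $f(\alpha q-b)>f(\alpha p-a)$ for all $(q,b)\in\mathbb{Z}^{n+1}$ with $1\le q\le p-1$ and for all $(p,b)$ with $b\ne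 a$. They form a sequence $(p_\nu,a_\nu)$ with $p_1<p_2<\dots$. *)

theory Defs
  imports "HOL-Analysis.Analysis"
begin

definition is_fnorm :: "(real^'n \<Rightarrow> real) \<Rightarrow> bool" where
  "is_fnorm f \<longleftrightarrow> continuous_on UNIV f \<and> (\<forall>x. f x \<ge> 0)
     \<and> (\<forall>x. f x = 0 \<longleftrightarrow> x = 0) \<and> (\<forall>x. f (-x) = f x)
     \<and> (\<forall>x t. t \<ge> 0 \<longrightarrow> f (t *\<^sub>R x) = t * f x)
     \<and> convex {y. f y \<le> 1} \<and> 0 \<in> interior {y. f y \<le> 1}"

definition fball :: "(real^'n \<Rightarrow> real) \<Rightarrow> real^'n \<Rightarrow> (real^'n) set" where
  "fball f a = {y. f (y - a) \<le> 1}"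

definition illuminated :: "(real^'n) set \<Rightarrow> real^'n \<Rightarrow> real^'n \<Rightarrow> bool" where
  "illuminated M b a \<longleftrightarrow> closed M \<and> convex M \<and> b \<in> frontier M \<and> a \<notin> M
     \<and> (\<exists>t>0. b + t *\<^sub>R (b - a) \<in> interior M)"

definition ivec :: "int^'n \<Rightarrow> real^'n" where
  "ivec b = (\<chi> i. of_int (b $ i))"

definition Q_lin_indep1 :: "real^'n \<Rightarrow> bool" where
  "Q_lin_indep1 \<alpha> \<longleftrightarrow> (\<forall>(c0::rat) (c::'n \<Rightarrow> rat).
      of_rat c0 + (\<Sum>i\<in>UNIV. of_rat (c i) * \<alpha> $ i) = 0 \<longrightarrow> c0 = 0 \<and> (\<forall>i. c i = 0))"

definition best_approx :: "(real^'n \<Rightarrow> real) \<Rightarrow> real^'n \<Rightarrow> int \<Rightarrow> int^'n \<Rightarrow> bool" where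
  "best_approx f \<alpha> p a \<longleftrightarrow> p \<ge> 1 \<and>
     (\<forall>q b. 1 \<le> q \<and> q \<le> p - 1 \<longrightarrow> f (of_int q *\<^sub>R \<alpha> - ivec b) > f (of_int p *\<^sub>R \<alpha> - ivec a)) \<and>
     (\<forall>b. b \<noteq> a \<longrightarrow> f (of_int p *\<^sub>R \<alpha> - ivec b) > f (of_int p *\<^sub>R \<alpha> - ivec a))"

text \<open>(P,A) is the sequence of all f-best approximations, ordered by increasing p
  (index 0 corresponds to nu = 1 in the paper).\<close>
definition best_approx_seq :: "(real^'n \<Rightarrow> real) \<Rightarrow> real^'n \<Rightarrow> (nat \<Rightarrow> int) \<Rightarrow> (nat \<Rightarrow> int^'n) \<Rightarrow> bool" where
  "best_approx_seq f \<alpha> P A \<longleftrightarrow> strict_mono P \<and> (\<forall>\<nu>. best_approx f \<alpha> (P \<nu>) (A \<nu>))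
     \<and> (\<forall>p a. best_approx f \<alpha> p a \<longrightarrow> (\<exists>\<nu>. P \<nu> = p \<and> A \<nu> = a))"

end

theory Submission
  imports Defs
begin

text \<open>
  The vector \<open>\<alpha>\<close> is the limit of rational points \<open>\<beta>\<^sub>\<nu> = a\<^sub>\<nu> / p\<^sub>\<nu>\<close> that carry the best approximations.
  Given a primitive \<open>(p, a)\<close> and \<open>\<beta> = a / p\<close>, choose the first point \<open>l = b - q \<beta>\<close> of the lattice
  \<open>\<int>\<^sup>n + \<int> \<beta>\<close> on a ray whose direction is close to \<open>\<theta>\<^sub>\<nu>\<close>, and put
  \<open>(p', a') = (q + k p, b + k a)\<close> with \<open>k\<close> large, so that \<open>a' / p' = \<beta> + l / p'\<close>.
  For \<open>\<alpha>\<close> near \<open>a' / p'\<close> an integer point \<open>(z, c)\<close> with \<open>0 < z < p'\<close> has \<open>c - z \<alpha>\<close> close to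
  \<open>x - (z / p') l\<close> with \<open>x = c - z \<beta>\<close> in the lattice. This is bounded away from \<open>0\<close> unless \<open>x\<close> is \<open>0\<close> or \<open>l\<close>,
  that is, unless \<open>(z, c)\<close> is a multiple of \<open>(p, a)\<close> or of the form \<open>(p', a') - i (p, a)\<close>.
  At \<open>\<alpha> = a' / p'\<close> the point \<open>(p', a') - (p, a)\<close> ties with \<open>(p, a)\<close>; illumination says that
  the tie is broken the right way when \<open>\<alpha>\<close> moves off \<open>a' / p'\<close> in a direction close to
  \<open>\<theta>\<^bsub>\<nu>+1\<^esub>\<close>. Nested cones with tips \<open>\<beta>\<^sub>\<nu>\<close> and axes \<open>\<theta>\<^sub>\<nu>\<close>, each chosen off one more rational
  hyperplane, then shrink to \<open>\<alpha>\<close>.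
\<close>

section \<open>Norm properties and comparison with the Euclidean norm\<close>

lemma fnormD:
  assumes "is_fnorm f"
  shows "f x \<ge> 0" "f x = 0 \<longleftrightarrow> x = 0" "f (- x) = f x" "f (x - y) = f (y - x)"
    "f (c *\<^sub>R x) = \<bar>c\<bar> * f x" "x \<noteq> 0 \<Longrightarrow> f x > 0"
proof -
  have neg: "f (- x) = f x" for x
    using assms by (simp add: is_fnorm_def)
  show "f x \<ge> 0" "f x = 0 \<longleftrightarrow> x = 0" "f (- x) = f x"
    using assms by (auto simp: is_fnorm_def)
  then show "x \<noteq> 0 \<Longrightarrow> f x > 0"
    by (simp add: order_less_le)
  show "f (x - y) = f (y - x)"
    using neg[of "x - y"] by simp
  have "t \<ge> 0 \<Longrightarrow> f (t *\<^sub>R x) = t * f x" for t x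
    using assms by (simp add: is_fnorm_def)
  from this[of c x] this[of "- c" "- x"] neg[of x] show "f (c *\<^sub>R x) = \<bar>c\<bar> * f x"
    by (cases "c \<ge> 0") auto
qed

text \<open>\<open>(x + y) / (f x + f y)\<close> is a convex combination of the unit vectors
  \<open>x / f x\<close> and \<open>y / f y\<close>, so convexity of the unit ball bounds its norm
  by 1.\<close>

lemma fnorm_triangle:
  assumes f: "is_fnorm f"
  shows "f (x + y) \<le> f x + f y"
proof (cases "x = 0 \<or> y = 0")
  case True
  then show ?thesis using fnormD(1)[OF f] fnormD(2)[OF f] by auto
next
  case False
  then have pos: "f x > 0" "f y > 0" using fnormD(6)[OF f] by auto
  have conv: "convex {z. f z \<le> 1}" using f by (simp add: is_fnorm_def)
  have unit: "inverse (f x) *\<^sub>R x \<in> {z. f z \<le> 1}" "inverse (f y) *\<^sub>R y \<in> {z. f z \<le> 1}"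
    using pos by (simp_all add: fnormD(5)[OF f])
  let ?s = "f x + f y"
  have "(f x / ?s) *\<^sub>R (inverse (f x) *\<^sub>R x) + (f y / ?s) *\<^sub>R (inverse (f y) *\<^sub>R y) \<in> {z. f z \<le> 1}"
    using pos by (intro convexD[OF conv unit]) (simp_all add: add_divide_distrib[symmetric])
  moreover have "(f x / ?s) *\<^sub>R (inverse (f x) *\<^sub>R x) + (f y / ?s) *\<^sub>R (inverse (f y) *\<^sub>R y)
      = inverse ?s *\<^sub>R (x + y)"
    using pos by (simp add: scaleR_add_right field_simps)
  ultimately have "f (inverse ?s *\<^sub>R (x + y)) \<le> 1" by simp
  then have "inverse ?s * f (x + y) \<le> 1" using pos by (simp only: fnormD(5)[OF f]) simp
  then show ?thesis using pos by (simp add: field_simps)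
qed

lemma fnorm_triangle_lower:
  assumes "is_fnorm f"
  shows "f x - f y \<le> f (x + y)" "f x - f y \<le> f (x - y)"
  using fnorm_triangle[OF assms, of "x + y" "- y"] fnorm_triangle[OF assms, of "x - y" y]
    fnormD(3)[OF assms, of y] by auto

lemma fnorm_bounded_above:
  assumes f: "is_fnorm f"
  obtains M where "M > 0" "\<And>x. f x \<le> M * norm x"
proof -
  have "0 \<in> interior {y. f y \<le> 1}" using f by (simp add: is_fnorm_def)
  then obtain d where d: "d > 0" "cball 0 d \<subseteq> {y. f y \<le> 1}"
    by (meson mem_interior_cball)
  have "f x \<le> inverse d * norm x" for x
  proof (cases "x = 0")
    case True
    then show ?thesis using fnormD(2)[OF f, of 0] by simp
  next
    case False
    have "(d / norm x) *\<^sub>R x \<in> cball 0 d" using d(1) False by simp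
    then have "f ((d / norm x) *\<^sub>R x) \<le> 1" using d(2) by blast
    then show ?thesis using d(1) False by (simp add: fnormD(5)[OF f] field_simps)
  qed
  then show thesis using that[of "inverse d"] d(1) by auto
qed

lemma fnorm_bounded_below:
  fixes f :: "real^'n \<Rightarrow> real"
  assumes f: "is_fnorm f"
  obtains c where "c > 0" "\<And>x. c * norm x \<le> f x"
proof -
  have "continuous_on (sphere (0::real^'n) 1) f"
    using f continuous_on_subset[of UNIV f "sphere 0 1"] by (simp add: is_fnorm_def)
  moreover have "sphere (0::real^'n) 1 \<noteq> {}" by simp
  ultimately obtain u where u: "u \<in> sphere 0 1" "\<And>y. y \<in> sphere 0 1 \<Longrightarrow> f u \<le> f y"
    using continuous_attains_inf[of "sphere (0::real^'n) 1" f] by auto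
  have pos: "f u > 0" using u(1) by (intro fnormD(6)[OF f]) auto
  have "f u * norm x \<le> f x" for x
  proof (cases "x = 0")
    case True
    then show ?thesis using fnormD(2)[OF f, of 0] by simp
  next
    case False
    then have "f u \<le> f (inverse (norm x) *\<^sub>R x)" by (intro u(2)) simp
    then show ?thesis using False by (simp add: fnormD(5)[OF f] field_simps)
  qed
  then show thesis by (rule that[OF pos])
qed

section \<open>Illumination as strict decrease of the norm\<close>

text \<open>The interior point supplied by illumination is \<open>- t b\<close>. By symmetry of
  \<open>f\<close> its distance to \<open>a\<close> is \<open>f (a + t b)\<close>, which is below 1
  because an interior point can still be pushed outward from the centre.\<close>

lemma illuminated_fballD:
  assumes f: "is_fnorm f" and ill: "illuminated (fball f a) 0 b"
  shows "f a = 1" "\<exists>t>0. f (a + t *\<^sub>R b) < f a"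
proof -
  have cont: "continuous_on UNIV (\<lambda>y. f (y - a))"
    using f by (intro continuous_on_compose2[of UNIV f UNIV "\<lambda>y. y - a"] continuous_intros)
      (simp_all add: is_fnorm_def)
  have "closed (fball f a)" and fr: "0 \<in> frontier (fball f a)"
    using ill by (auto simp: illuminated_def)
  then have "f (0 - a) \<le> 1" by (auto simp: frontier_def fball_def)
  moreover have "\<not> f (0 - a) < 1"
  proof
    assume "f (0 - a) < 1"
    moreover have "open {y. f (y - a) < 1}"
      using cont by (intro open_Collect_less) auto
    ultimately have "0 \<in> interior (fball f a)"
      by (intro interiorI[of "{y. f (y - a) < 1}"]) (auto simp: fball_def)
    then show False using fr by (simp add: frontier_def)
  qed
  ultimately show one: "f a = 1" using fnormD(3)[OF f, of a] by simp
  obtain t where t: "t > 0" "- t *\<^sub>R b \<in> interior (fball f a)"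
    using ill by (auto simp: illuminated_def)
  define y where "y = - t *\<^sub>R b - a"
  have fy: "f y = f (a + t *\<^sub>R b)"
    using fnormD(3)[OF f, of y] by (simp add: y_def algebra_simps)
  have "f y < 1"
  proof (cases "y = 0")
    case True
    then show ?thesis using fnormD(2)[OF f, of y] by simp
  next
    case False
    from t(2) obtain d where d: "d > 0" "cball (- t *\<^sub>R b) d \<subseteq> fball f a"
      by (meson mem_interior_cball)
    have "- t *\<^sub>R b + (d / norm y) *\<^sub>R y \<in> cball (- t *\<^sub>R b) d"
      using d(1) False by (simp add: dist_norm)
    then have "f (- t *\<^sub>R b + (d / norm y) *\<^sub>R y - a) \<le> 1"
      using d(2) unfolding fball_def by blast
    moreover have "- t *\<^sub>R b + (d / norm y) *\<^sub>R y - a = y + (d / norm y) *\<^sub>R y"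
      by (simp add: y_def)
    moreover have "y + (d / norm y) *\<^sub>R y = (1 + d / norm y) *\<^sub>R y"
      by (simp add: scaleR_left_distrib)
    ultimately have "(1 + d / norm y) * f y \<le> 1"
      using d(1) by (simp add: fnormD(5)[OF f])
    moreover have "f y > 0" "d / norm y > 0" using False fnormD(6)[OF f] d(1) by auto
    ultimately show ?thesis
      by (smt (verit) mult_less_cancel_right1 mult_pos_pos distrib_right)
  qed
  then show "\<exists>t>0. f (a + t *\<^sub>R b) < f a" using t(1) fy one by auto
qed

lemma fnorm_descent_nhds:
  assumes f: "is_fnorm f" and less: "f (a + t *\<^sub>R b) < f a" and t: "t > 0"
  obtains d where "d > 0" "\<And>v w. v \<in> ball a d \<Longrightarrow> w \<in> ball b d \<Longrightarrow> f (v + t *\<^sub>R w) < f v"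
proof -
  obtain M where M: "M > 0" "\<And>x. f x \<le> M * norm x"
    using fnorm_bounded_above[OF f] by blast
  \<comment> \<open>Moving \<open>a\<close> to \<open>v\<close> changes each side by less than
    \<open>M * d\<close>, and moving \<open>b\<close> to \<open>w\<close> changes the left side by
    less than \<open>t * M * d\<close>; the total is the gap.\<close>
  define d where "d = (f a - f (a + t *\<^sub>R b)) / (M * (2 + t))"
  have d: "d > 0" "M * d * (2 + t) = f a - f (a + t *\<^sub>R b)"
    using M(1) t less by (simp_all add: d_def)
  have "f (v + t *\<^sub>R w) < f v" if "v \<in> ball a d" "w \<in> ball b d" for v w
  proof -
    have "f (v - a) < M * d" "f (w - b) < M * d"
      using that M(1) by (auto intro!: order.strict_trans1[OF M(2)] simp: dist_norm norm_minus_commute)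
    then have "t * f (w - b) < t * (M * d)" using t by simp
    moreover have "f (v + t *\<^sub>R w) \<le> f (a + t *\<^sub>R b) + f (v - a) + t * f (w - b)"
    proof -
      have eq: "v + t *\<^sub>R w = (a + t *\<^sub>R b) + (v - a) + t *\<^sub>R (w - b)"
        by (simp add: scaleR_diff_right)
      show ?thesis
        unfolding eq
        using fnorm_triangle[OF f, of "a + t *\<^sub>R b + (v - a)" "t *\<^sub>R (w - b)"]
          fnorm_triangle[OF f, of "a + t *\<^sub>R b" "v - a"] fnormD(5)[OF f, of t "w - b"] t
        by linarith
    qed
    moreover have "f a - f (v - a) \<le> f v"
      using fnorm_triangle_lower(1)[OF f, of a "v - a"] by simp
    ultimately show ?thesis using d(2) \<open>f (v - a) < M * d\<close> by (simp add: algebra_simps)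
  qed
  then show thesis using that d(1) by blast
qed

text \<open>The function \<open>f (v + s w)\<close> of \<open>s\<close> is convex and smaller at
  \<open>t\<close> than at 0. Hence it is at most \<open>f v\<close> on \<open>[0, t]\<close> and
  above \<open>f v\<close> at negative arguments.\<close>

lemma fnorm_descent_line:
  assumes f: "is_fnorm f" and less: "f (v + t *\<^sub>R w) < f v" and t: "t > 0"
    and x: "0 \<le> x" "x \<le> t" and y: "y > 0"
  shows "f (v + x *\<^sub>R w) < f (v - y *\<^sub>R w)"
proof -
  have "v + x *\<^sub>R w = (1 - x / t) *\<^sub>R v + (x / t) *\<^sub>R (v + t *\<^sub>R w)"
    using t by (simp add: algebra_simps)
  then have "f (v + x *\<^sub>R w) \<le> (1 - x / t) * f v + (x / t) * f (v + t *\<^sub>R w)"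
    using fnorm_triangle[OF f, of "(1 - x / t) *\<^sub>R v" "(x / t) *\<^sub>R (v + t *\<^sub>R w)"] x t
    by (simp add: fnormD(5)[OF f])
  also have "\<dots> \<le> (1 - x / t) * f v + (x / t) * f v"
    using x t less by (intro add_left_mono mult_left_mono) auto
  finally have 1: "f (v + x *\<^sub>R w) \<le> f v" by (simp add: algebra_simps)
  have "(t + y) *\<^sub>R v = t *\<^sub>R (v - y *\<^sub>R w) + y *\<^sub>R (v + t *\<^sub>R w)"
    by (simp add: algebra_simps)
  then have "(t + y) * f v \<le> t * f (v - y *\<^sub>R w) + y * f (v + t *\<^sub>R w)"
    using fnorm_triangle[OF f, of "t *\<^sub>R (v - y *\<^sub>R w)" "y *\<^sub>R (v + t *\<^sub>R w)"]
      fnormD(5)[OF f, of "t + y" v] t y by (simp add: fnormD(5)[OF f])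
  also have "\<dots> < t * f (v - y *\<^sub>R w) + y * f v" using less y by simp
  finally have "t * f v < t * f (v - y *\<^sub>R w)" by (simp add: algebra_simps)
  then show ?thesis using 1 t by simp
qed

section \<open>Integer points projected along a rational direction\<close>

lemma ivec_simps [simp]:
  "ivec (a + b) = ivec a + ivec b" "ivec (a - b) = ivec a - ivec b" "ivec 0 = 0"
  "ivec (k *s a) = of_int k *\<^sub>R ivec a" "ivec a = ivec b \<longleftrightarrow> a = b"
  by (auto simp: ivec_def vec_eq_iff)

lemma ivec_less_1_imp_0: "norm (ivec a) < 1 \<Longrightarrow> a = 0"
proof -
  assume "norm (ivec a) < 1"
  then have "\<bar>of_int (a $ i)\<bar> < (1::real)" for i
    using component_le_norm_cart[of "ivec a" i] by (simp add: ivec_def)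
  then have "real_of_int \<bar>a $ i\<bar> < 1" for i by simp
  then have "a $ i = 0" for i by (metis of_int_less_1_iff zero_less_abs_iff zless_imp_add1_zle not_less add_0)
  then show "a = 0" by (simp add: vec_eq_iff)
qed

text \<open>The projection of Z^(n+1) along the line through \<open>(1, \<beta>)\<close>.\<close>

definition proj_lattice :: "real^'n \<Rightarrow> (real^'n) set" where
  "proj_lattice \<beta> = {ivec c - of_int z *\<^sub>R \<beta> | z c. True}"

lemma proj_latticeI: "ivec c - of_int z *\<^sub>R \<beta> \<in> proj_lattice \<beta>"
  by (auto simp: proj_lattice_def)

lemma proj_lattice_cleared:
  assumes "of_int p *\<^sub>R \<beta> = ivec a" "x \<in> proj_lattice \<beta>"
  obtains k where "of_int p *\<^sub>R x = ivec k"
proof -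
  from assms(2) obtain z c where x: "x = ivec c - of_int z *\<^sub>R \<beta>"
    by (auto simp: proj_lattice_def)
  have "of_int p *\<^sub>R x = of_int p *\<^sub>R ivec c - of_int z *\<^sub>R (of_int p *\<^sub>R \<beta>)"
    by (simp add: x scaleR_diff_right)
  then have "of_int p *\<^sub>R x = ivec (p *s c - z *s a)" using assms(1) by simp
  then show thesis using that by blast
qed

text \<open>Multiplication by \<open>p\<close> maps these points to integer vectors, so distinct
  ones lie at least \<open>1 / p\<close> apart.\<close>

lemma closed_subset_proj_lattice:
  assumes "p \<ge> 1" "of_int p *\<^sub>R \<beta> = ivec a" "S \<subseteq> proj_lattice \<beta>"
  shows "closed S"
proof (rule discrete_imp_closed[of "1 / of_int p"])
  show "\<forall>x\<in>S. \<forall>y\<in>S. dist y x < 1 / of_int p \<longrightarrow> y = x"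
  proof (intro ballI impI)
    fix x y assume xy: "x \<in> S" "y \<in> S" "dist y x < 1 / of_int p"
    obtain k l where kl: "of_int p *\<^sub>R x = ivec k" "of_int p *\<^sub>R y = ivec l"
      using xy assms(2,3) proj_lattice_cleared by (metis subsetD)
    have "ivec (l - k) = of_int p *\<^sub>R (y - x)"
      using kl by (simp add: scaleR_diff_right)
    moreover have "of_int p * norm (y - x) < 1"
      using xy(3) assms(1) by (simp add: dist_norm field_simps)
    ultimately have "norm (ivec (l - k)) < 1" using assms(1) by simp
    then have "l = k" using ivec_less_1_imp_0[of "l - k"] by simp
    then show "y = x" using kl assms(1) by (metis of_int_eq_0_iff scaleR_cancel_left not_one_le_zero)
  qed
qed (use assms(1) in simp)

text \<open>Taking the first point makes the next pair primitive and keeps the segment from 0 to it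
  clear of other lattice points.\<close>

lemma proj_lattice_first_on_ray:
  assumes p: "p \<ge> 1" "of_int p *\<^sub>R \<beta> = ivec a" and v: "v \<noteq> 0"
    and N: "N > 0" "N *\<^sub>R v \<in> proj_lattice \<beta>"
  obtains S where "S > 0" "S *\<^sub>R v \<in> proj_lattice \<beta>"
    "\<And>u. 0 < u \<Longrightarrow> u < S \<Longrightarrow> u *\<^sub>R v \<notin> proj_lattice \<beta>"
proof -
  obtain i where i: "v $ i \<noteq> 0" using v by (auto simp: vec_eq_iff)
  \<comment> \<open>On lattice points of the ray the quantity under the floor is an integer.\<close>
  define m where "m u = nat \<lfloor>of_int p * u * \<bar>v $ i\<bar>\<rfloor>" for u
  let ?P = "\<lambda>u. u > 0 \<and> u *\<^sub>R v \<in> proj_lattice \<beta>"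
  obtain S where S: "?P S" "\<And>u. ?P u \<Longrightarrow> m S \<le> m u"
    using ex_has_least_nat[of ?P N m] N by auto
  have int: "of_int p * u * \<bar>v $ i\<bar> = of_int \<lfloor>of_int p * u * \<bar>v $ i\<bar>\<rfloor>" if u: "?P u" for u
  proof -
    obtain k where "of_int p *\<^sub>R (u *\<^sub>R v) = ivec k"
      using proj_lattice_cleared[OF p(2)] u by metis
    then have "of_int p * u * (v $ i) = of_int (k $ i)"
      by (simp add: vec_eq_iff ivec_def mult.assoc)
    then have "of_int p * u * \<bar>v $ i\<bar> = of_int \<bar>k $ i\<bar>"
      using u p(1) abs_mult[of "of_int p * u" "v $ i"] by simp
    then show ?thesis by (metis floor_of_int)
  qed
  have False if "0 < u" "u < S" "u *\<^sub>R v \<in> proj_lattice \<beta>" for u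
  proof -
    have "of_int p * u * \<bar>v $ i\<bar> < of_int p * S * \<bar>v $ i\<bar>" "0 \<le> of_int p * u * \<bar>v $ i\<bar>"
      using that i p(1) by simp_all
    then have "m u < m S"
      using int[of u] int[of S] that S(1) unfolding m_def by (smt (verit) nat_less_eq_zless of_int_less_iff zero_le_floor)
    then show False using S(2)[of u] that by simp
  qed
  then show thesis using that S(1) by blast
qed

section \<open>Primitive points and isolation near a rational point\<close>

text \<open>For \<open>p \<ge> 1\<close> this is coprimality of \<open>p\<close> and the coordinates
  of \<open>a\<close>, phrased through the order of \<open>a / p\<close> modulo integer
  vectors.\<close>

definition primitive_point :: "int \<Rightarrow> int^'n \<Rightarrow> bool" where
  "primitive_point p a \<longleftrightarrow> (\<forall>z c. of_int z *\<^sub>R ivec a = of_int p *\<^sub>R ivec c \<longrightarrow> p dvd z)"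

text \<open>Used to identify the integer points that project to 0.\<close>

lemma primitive_point_multiple:
  assumes "primitive_point p a" "p \<ge> 1" "of_int p *\<^sub>R \<beta> = ivec a" "ivec c = of_int z *\<^sub>R \<beta>"
  obtains j where "z = j * p" "ivec c = of_int j *\<^sub>R ivec a"
proof -
  have "of_int z *\<^sub>R ivec a = of_int p *\<^sub>R ivec c"
    by (simp add: assms(3)[symmetric] assms(4))
  then have "p dvd z" using assms(1) by (auto simp: primitive_point_def)
  then obtain j where j: "z = j * p" by (metis dvdE mult.commute)
  have "ivec c = of_int j *\<^sub>R (of_int p *\<^sub>R \<beta>)" by (simp add: assms(4) j)
  then show thesis using that[OF j] assms(3) by simp
qed

text \<open>Together with \<open>p < p'\<close> this says that \<open>(p, a)\<close> is a best approximation and that the next one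
  has denominator at least \<open>p'\<close>.\<close>

definition isolates :: "(real^'n \<Rightarrow> real) \<Rightarrow> real^'n \<Rightarrow> int \<Rightarrow> int^'n \<Rightarrow> int \<Rightarrow> bool" where
  "isolates f \<alpha> p a p' \<longleftrightarrow> (\<forall>z c. 1 \<le> z \<longrightarrow> z < p' \<longrightarrow> (z, c) \<noteq> (p, a) \<longrightarrow>
     f (of_int p *\<^sub>R \<alpha> - ivec a) < f (of_int z *\<^sub>R \<alpha> - ivec c))"

text \<open>Here \<open>\<xi>\<close> is close to \<open>(p / p') l\<close> and
  \<open>\<eta> = p' \<sigma>\<close>. The first bound in \<open>small\<close> keeps the main part
  of \<open>\<xi>\<close> below \<open>d / 2\<close>, the second keeps each perturbation by
  \<open>\<sigma>\<close> below \<open>d / 4\<close>, and the third makes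
  \<open>f \<eta> < f \<xi>\<close>. The hypothesis \<open>ill\<close> breaks the one remaining
  tie.\<close>

lemma isolatesI_near_rational:
  fixes f :: "real^'n \<Rightarrow> real" and p p' :: int and a a' :: "int^'n" and \<beta> \<beta>' \<sigma> :: "real^'n"
  defines "\<xi> \<equiv> of_int p *\<^sub>R (\<beta>' + \<sigma>) - ivec a" and "\<eta> \<equiv> of_int p' *\<^sub>R (\<beta>' + \<sigma>) - ivec a'"
  assumes f: "is_fnorm f" and p: "1 \<le> p" "p < p'" "of_int p *\<^sub>R \<beta> = ivec a" "primitive_point p a"
    and p': "of_int p' *\<^sub>R \<beta>' = ivec a'" and l: "l = ivec a' - of_int p' *\<^sub>R \<beta>"
    and gap: "\<And>x u. x \<in> proj_lattice \<beta> - {0, l} \<Longrightarrow> u \<in> {0..1} \<Longrightarrow> d \<le> f (x - u *\<^sub>R l)"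
    and small: "2 * of_int p * f l < d * of_int p'" "4 * of_int p' * f \<sigma> < d"
      "2 * of_int p' * f \<sigma> < of_int p * f l / of_int p'"
    and ill: "f \<xi> < f (\<xi> - \<eta>)"
  shows "isolates f (\<beta>' + \<sigma>) p a p'"
  unfolding isolates_def
proof (intro allI impI)
  fix z c assume z: "1 \<le> z" "z < p'" and ne: "(z, c) \<noteq> (p, a)"
  define P P' Z where "P = real_of_int p" "P' = real_of_int p'" "Z = real_of_int z"
  have P: "1 \<le> P" "P < P'" "1 \<le> Z" "Z < P'" using p z by (auto simp: P_P'_Z_def)
  have "l = P' *\<^sub>R (\<beta>' - \<beta>)" by (simp add: l p' P_P'_Z_def scaleR_diff_right)
  then have \<beta>': "\<beta>' = \<beta> + inverse P' *\<^sub>R l" using P by simp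
  have pos: "f \<sigma> \<ge> 0" using fnormD(1)[OF f] .
  have \<eta>: "\<eta> = P' *\<^sub>R \<sigma>"
    by (simp add: \<eta>_def p' P_P'_Z_def scaleR_add_right)
  have \<xi>: "\<xi> = (P / P') *\<^sub>R l + P *\<^sub>R \<sigma>"
    using p(3) by (simp add: \<xi>_def \<beta>' P_P'_Z_def scaleR_add_right divide_inverse)
  have \<xi>_le: "f \<xi> \<le> P * f l / P' + P * f \<sigma>"
    unfolding \<xi> using fnorm_triangle[OF f, of "(P / P') *\<^sub>R l" "P *\<^sub>R \<sigma>"] P
    by (simp add: fnormD(5)[OF f])
  have \<xi>_ge: "P * f l / P' - P * f \<sigma> \<le> f \<xi>"
    unfolding \<xi> using fnorm_triangle_lower(1)[OF f, of "(P / P') *\<^sub>R l" "P *\<^sub>R \<sigma>"] P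
    by (simp add: fnormD(5)[OF f])
  have P\<sigma>: "P * f \<sigma> \<le> P' * f \<sigma>" using P pos by (intro mult_right_mono) auto
  \<comment> \<open>This excludes the points \<open>(p', a') - i (p, a)\<close> with \<open>i \<ge> 2\<close>.\<close>
  have \<eta>_lt: "f \<eta> < f \<xi>"
    using \<xi>_ge small(3) P\<sigma> P by (simp add: \<eta> fnormD(5)[OF f] P_P'_Z_def[symmetric])
  have \<xi>_pos: "f \<xi> > 0" using \<eta>_lt fnormD(1)[OF f, of \<eta>] by simp
  define x where "x = ivec c - Z *\<^sub>R \<beta>"
  consider (zero) "x = 0" | (last) "x = l" | (far) "x \<in> proj_lattice \<beta> - {0, l}"
    using proj_latticeI by (auto simp: x_def P_P'_Z_def)
  then have "f \<xi> < f (of_int z *\<^sub>R (\<beta>' + \<sigma>) - ivec c)"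
  proof cases
    case zero
    then have "ivec c = of_int z *\<^sub>R \<beta>" by (simp add: x_def P_P'_Z_def)
    then obtain j where j: "z = j * p" "ivec c = of_int j *\<^sub>R ivec a"
      using primitive_point_multiple p by metis
    have "j \<noteq> 1" using ne j by auto
    moreover have "j > 0" using j(1) z(1) p(1) by (smt (verit) mult_nonpos_nonneg)
    ultimately have "real_of_int j > 1" by simp
    moreover have "of_int z *\<^sub>R (\<beta>' + \<sigma>) - ivec c = of_int j *\<^sub>R \<xi>"
      by (simp add: j \<xi>_def scaleR_diff_right)
    ultimately show ?thesis using \<xi>_pos by (simp add: fnormD(5)[OF f])
  next
    case last
    \<comment> \<open>Now \<open>(p', a') - (z, c)\<close> projects to 0, so it is
      \<open>i (p, a)\<close> with \<open>i > 0\<close>, and the error is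
      \<open>\<eta> - i \<xi>\<close>. For \<open>i = 1\<close> the hypothesis \<open>ill\<close>
      applies; for \<open>i \<ge> 2\<close> the norm is at least
      \<open>2 f \<xi> - f \<eta> > f \<xi>\<close>.\<close>
    then have "ivec (a' - c) = of_int (p' - z) *\<^sub>R \<beta>"
      by (simp add: x_def l P_P'_Z_def algebra_simps)
    then obtain i where i: "p' - z = i * p" "ivec (a' - c) = of_int i *\<^sub>R ivec a"
      using primitive_point_multiple p by metis
    have "i > 0" using i(1) z p(1) by (smt (verit) mult_nonpos_nonneg)
    have "real_of_int z = of_int p' - of_int i * of_int p"
      using i(1) by (metis add_diff_cancel_left' diff_add_cancel of_int_diff of_int_mult)
    moreover have "ivec c = ivec a' - of_int i *\<^sub>R ivec a" using i(2) by (simp add: algebra_simps)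
    ultimately have eq: "of_int z *\<^sub>R (\<beta>' + \<sigma>) - ivec c = \<eta> - of_int i *\<^sub>R \<xi>"
      by (simp add: \<eta>_def \<xi>_def scaleR_diff_left scaleR_diff_right)
    show ?thesis
    proof (cases "i = 1")
      case True
      then show ?thesis using eq ill fnormD(4)[OF f] by simp
    next
      case False
      then have "real_of_int i \<ge> 2" using \<open>i > 0\<close> by simp
      then have "2 * f \<xi> \<le> of_int i * f \<xi>" using \<xi>_pos by (intro mult_right_mono) auto
      then show ?thesis
        using fnorm_triangle_lower(2)[OF f, of "of_int i *\<^sub>R \<xi>" \<eta>] \<eta>_lt \<open>i > 0\<close>
        unfolding eq by (simp add: fnormD(5)[OF f] fnormD(4)[OF f, of \<eta>])
    qed
  next
    case far
    \<comment> \<open>The error differs by less than \<open>d / 4\<close> from a vector of norm at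
      least \<open>d\<close>, so its norm exceeds \<open>3 d / 4\<close>, while
      \<open>f \<xi>\<close> stays below \<open>d / 2 + d / 4\<close>.\<close>
    have eq: "of_int z *\<^sub>R (\<beta>' + \<sigma>) - ivec c = Z *\<^sub>R \<sigma> - (x - (Z / P') *\<^sub>R l)"
      by (simp add: x_def \<beta>' P_P'_Z_def divide_inverse scaleR_add_right)
    have "Z / P' \<in> {0..1}" using P by simp
    then have "d \<le> f (x - (Z / P') *\<^sub>R l)" using gap far by blast
    moreover have "f (x - (Z / P') *\<^sub>R l) - Z * f \<sigma> \<le> f (of_int z *\<^sub>R (\<beta>' + \<sigma>) - ivec c)"
      using fnorm_triangle_lower(2)[OF f, of "x - (Z / P') *\<^sub>R l" "Z *\<^sub>R \<sigma>"] P
      unfolding eq by (simp add: fnormD(5)[OF f] fnormD(4)[OF f, of "Z *\<^sub>R \<sigma>"])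
    moreover have "Z * f \<sigma> \<le> P' * f \<sigma>" using P pos by (intro mult_right_mono) auto
    moreover have "P * f l / P' < d / 2" using small(1) P by (simp add: P_P'_Z_def field_simps)
    moreover have "4 * P' * f \<sigma> < d" using small(2) by (simp add: P_P'_Z_def)
    ultimately show ?thesis using \<xi>_le P\<sigma> by linarith
  qed
  then show "f (of_int p *\<^sub>R (\<beta>' + \<sigma>) - ivec a) < f (of_int z *\<^sub>R (\<beta>' + \<sigma>) - ivec c)"
    by (simp only: \<xi>_def)
qed

text \<open>If \<open>z a' / p'\<close> is integral, the remainder \<open>y\<close> of
  \<open>z\<close> modulo \<open>p'\<close> makes \<open>(y / p') l\<close> a lattice point. As none
  lies strictly between 0 and \<open>l\<close>, the remainder is 0.\<close>

lemma primitive_point_mediant: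
  assumes p: "1 \<le> p" "1 \<le> p'" "of_int p *\<^sub>R \<beta> = ivec a" "primitive_point p a"
    and l: "l = ivec a' - of_int p' *\<^sub>R \<beta>" "l \<noteq> 0"
    and first: "\<And>u. 0 < u \<Longrightarrow> u < 1 \<Longrightarrow> u *\<^sub>R l \<notin> proj_lattice \<beta>"
  shows "primitive_point p' a'"
  unfolding primitive_point_def
proof (intro allI impI)
  fix z c assume eq: "of_int z *\<^sub>R ivec a' = of_int p' *\<^sub>R ivec c"
  define y where "y = z mod p'"
  define b where "b = c - (z div p') *s a'"
  have z: "z = y + (z div p') * p'" by (simp add: y_def)
  have y: "0 \<le> y" "y < p'" using p(2) by (simp_all add: y_def)
  have "of_int z = (of_int y + of_int (z div p') * of_int p' :: real)"
    by (subst z) simp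
  then have "of_int p' *\<^sub>R ivec b = of_int y *\<^sub>R ivec a'"
    using eq by (simp add: b_def algebra_simps)
  then have "of_int p' *\<^sub>R (ivec b - of_int y *\<^sub>R \<beta>) = of_int y *\<^sub>R l"
    by (simp add: l(1) algebra_simps)
  then have "inverse (of_int p') *\<^sub>R (of_int p' *\<^sub>R (ivec b - of_int y *\<^sub>R \<beta>))
      = inverse (of_int p') *\<^sub>R (of_int y *\<^sub>R l)"
    by (rule arg_cong)
  then have "ivec b - of_int y *\<^sub>R \<beta> = (of_int y / of_int p') *\<^sub>R l"
    using p(2) by (simp add: divide_inverse mult.commute)
  then have "(of_int y / of_int p') *\<^sub>R l \<in> proj_lattice \<beta>"
    by (metis proj_latticeI)
  moreover have "of_int y / of_int p' < (1::real)" using y by simp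
  moreover have "0 < of_int y / (of_int p' :: real)" if "y \<noteq> 0" using y that by simp
  ultimately have "y = 0" using first by blast
  then show "p' dvd z" by (simp add: y_def dvd_eq_mod_eq_0)
qed

section \<open>Truncated cones and the refinement step\<close>

text \<open>At a point \<open>\<beta> + s w\<close> with \<open>w\<close> near
  \<open>\<theta>\<close>, the relation \<open>p \<beta> = a\<close> turns the approximation error
  into \<open>p s w\<close>, so cones control its direction. The union of balls makes openness
  immediate.\<close>

definition tip_cone :: "real^'n \<Rightarrow> real^'n \<Rightarrow> real \<Rightarrow> real \<Rightarrow> (real^'n) set" where
  "tip_cone \<beta> \<theta> e r = (\<Union>s\<in>{0<..<r}. ball (\<beta> + s *\<^sub>R \<theta>) (s * e))"

lemma mem_tip_cone_iff:
  "x \<in> tip_cone \<beta> \<theta> e r \<longleftrightarrow> (\<exists>s w. 0 < s \<and> s < r \<and> w \<in> ball \<theta> e \<and> x = \<beta> + s *\<^sub>R w)"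
proof -
  have "w \<in> ball \<theta> e \<longleftrightarrow> \<beta> + s *\<^sub>R w \<in> ball (\<beta> + s *\<^sub>R \<theta>) (s * e)" if "s > 0" for s w
    using that by (simp add: dist_norm scaleR_diff_right[symmetric])
  moreover have "x = \<beta> + s *\<^sub>R (inverse s *\<^sub>R (x - \<beta>))" if "s > 0" for s
    using that by simp
  ultimately show ?thesis unfolding tip_cone_def by (smt (verit) UN_iff greaterThanLessThan_iff)
qed

lemma open_tip_cone: "open (tip_cone \<beta> \<theta> e r)"
  by (auto simp: tip_cone_def)

text \<open>The open cones are not compact; these closed balls serve in the nested
  intersection.\<close>

lemma tip_cone_subset_cball: "tip_cone \<beta> \<theta> e r \<subseteq> cball \<beta> (r * (norm \<theta> + e))"
proof
  fix x assume "x \<in> tip_cone \<beta> \<theta> e r"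
  then obtain s w where sw: "0 < s" "s < r" "w \<in> ball \<theta> e" "x = \<beta> + s *\<^sub>R w"
    by (auto simp: mem_tip_cone_iff)
  have "norm w \<le> norm \<theta> + e"
    using sw(3) norm_triangle_sub[of w \<theta>] by (simp add: dist_norm norm_minus_commute)
  then have "s * norm w \<le> r * (norm \<theta> + e)" using sw by (intro mult_mono) auto
  then show "x \<in> cball \<beta> (r * (norm \<theta> + e))" using sw by (simp add: dist_norm)
qed

text \<open>Rounding \<open>N x\<close> down to an integer vector costs at most 1 per coordinate, so
  after division by \<open>N\<close> the error is at most \<open>CARD('n) / N < d\<close>.\<close>

lemma open_contains_rational_direction:
  fixes W :: "(real^'n) set"
  assumes "open W" "W \<noteq> {}"
  obtains v N m where "v \<in> W" "N > 0" "N *\<^sub>R v = ivec m"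
proof -
  obtain x d where x: "d > 0" "ball x d \<subseteq> W" using assms by (meson ex_in_conv openE)
  \<comment> \<open>\<open>N\<close> need not be an integer: only \<open>N v \<in> \<int>\<^sup>n\<close> matters.\<close>
  define N where "N = real CARD('n) / d + 1"
  define m where "m = (\<chi> i. \<lfloor>N * x $ i\<rfloor>)"
  have N: "N > 0" "real CARD('n) < d * N" using x(1) by (simp_all add: N_def add_pos_pos distrib_left)
  have "N * norm (inverse N *\<^sub>R ivec m - x) = norm (ivec m - N *\<^sub>R x)"
  proof -
    have "ivec m - N *\<^sub>R x = N *\<^sub>R (inverse N *\<^sub>R ivec m - x)" using N by (simp add: scaleR_diff_right)
    then show ?thesis using N by simp
  qed
  also have "\<dots> \<le> (\<Sum>i\<in>UNIV. \<bar>(ivec m - N *\<^sub>R x) $ i\<bar>)" by (rule norm_le_l1_cart)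
  also have "\<dots> \<le> (\<Sum>i\<in>(UNIV::'n set). 1)"
    by (intro sum_mono) (simp add: ivec_def m_def, linarith)
  also have "\<dots> < d * N" using N by simp
  finally have "inverse N *\<^sub>R ivec m \<in> ball x d"
    using N by (simp add: dist_norm norm_minus_commute mult.commute)
  then show thesis using that[of "inverse N *\<^sub>R ivec m" N m] N x(2) by auto
qed

lemma ball_not_subset_hyperplane:
  fixes g :: "real^'n"
  assumes "e > 0" "g \<noteq> 0"
  obtains x where "x \<in> ball \<theta> e" "g \<bullet> x \<noteq> 0"
proof (cases "g \<bullet> \<theta> = 0")
  case True
  have "\<theta> + (e / (2 * norm g)) *\<^sub>R g \<in> ball \<theta> e" using assms by (simp add: dist_norm)
  moreover have "g \<bullet> (\<theta> + (e / (2 * norm g)) *\<^sub>R g) \<noteq> 0"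
    using assms True by (simp add: inner_add_right)
  ultimately show thesis using that by blast
next
  case False
  then show thesis using that[of \<theta>] assms by simp
qed

text \<open>The choices are made in the order \<open>v\<close>, \<open>l\<close>, \<open>d\<close>,
  \<open>p'\<close>, \<open>r'\<close>. The gap \<open>d\<close> does not depend on
  \<open>p'\<close>, so \<open>p'\<close> can be taken large against it; \<open>r'\<close> is then
  taken small against \<open>p'\<close>.\<close>

lemma tip_cone_refine:
  fixes f :: "real^'n \<Rightarrow> real" and \<beta> :: "real^'n"
  assumes f: "is_fnorm f" and p: "1 \<le> p" "of_int p *\<^sub>R \<beta> = ivec a" "primitive_point p a"
    and pos: "e > 0" "e' > 0" "r > 0" "t > 0"
    and descent: "\<And>v w. v \<in> ball \<theta> e \<Longrightarrow> w \<in> ball \<theta>' e' \<Longrightarrow> f (v + t *\<^sub>R w) < f v"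
    and g: "g0 \<noteq> 0 \<or> g \<noteq> 0"
  obtains p' a' r' \<beta>' where "p < p'" "of_int p' *\<^sub>R \<beta>' = ivec a'" "primitive_point p' a'" "r' > 0"
    "cball \<beta>' (r' * (norm \<theta>' + e')) \<subseteq> tip_cone \<beta> \<theta> e r \<inter> {x. g0 + g \<bullet> x \<noteq> 0}"
    "\<And>\<alpha>. \<alpha> \<in> tip_cone \<beta>' \<theta>' e' r' \<Longrightarrow> isolates f \<alpha> p a p'"
proof -
  obtain M where M: "M > 0" "\<And>x. f x \<le> M * norm x" using fnorm_bounded_above[OF f] by blast
  obtain \<kappa> where \<kappa>: "\<kappa> > 0" "\<And>x. \<kappa> * norm x \<le> f x" using fnorm_bounded_below[OF f] by blast
  \<comment> \<open>For \<open>g \<noteq> 0\<close>, a direction not orthogonal to \<open>g\<close>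
    leaves the hyperplane \<open>g0 + g \<bullet> x = 0\<close> even when \<open>\<beta>\<close>
    lies on it.\<close>
  define W where "W = {x \<in> ball \<theta> e. g \<noteq> 0 \<longrightarrow> g \<bullet> x \<noteq> 0}"
  have "open W"
  proof (cases "g = 0")
    case False
    have "W = ball \<theta> e \<inter> {x. g \<bullet> x \<noteq> 0}" using False by (auto simp: W_def)
    moreover have "open {x. g \<bullet> x \<noteq> 0}" by (intro open_Collect_neq continuous_intros)
    ultimately show ?thesis by auto
  next
    case True
    then have "W = ball \<theta> e" by (auto simp: W_def)
    then show ?thesis by simp
  qed
  moreover have "W \<noteq> {}"
  proof (cases "g = 0")
    case False
    then obtain x where "x \<in> ball \<theta> e" "g \<bullet> x \<noteq> 0"
      using ball_not_subset_hyperplane[OF pos(1)] by blast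
    then show ?thesis by (auto simp: W_def)
  next
    case True
    then have "\<theta> \<in> W" using pos(1) by (simp add: W_def)
    then show ?thesis by blast
  qed
  ultimately obtain v N m where v: "v \<in> W" "N > 0" "N *\<^sub>R v = ivec m"
    by (rule open_contains_rational_direction)
  have vball: "v \<in> ball \<theta> e" and gv: "g \<noteq> 0 \<Longrightarrow> g \<bullet> v \<noteq> 0" using v(1) by (auto simp: W_def)
  have "f v > 0"
    using descent[OF vball, of \<theta>'] pos(2) fnormD(1)[OF f, of "v + t *\<^sub>R \<theta>'"] by simp
  then have "v \<noteq> 0" using fnormD(2)[OF f, of v] by auto
  moreover have "N *\<^sub>R v \<in> proj_lattice \<beta>"
    using proj_latticeI[of m 0 \<beta>] v(3) by simp
  ultimately obtain S where S: "S > 0" "S *\<^sub>R v \<in> proj_lattice \<beta>"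
    "\<And>u. 0 < u \<Longrightarrow> u < S \<Longrightarrow> u *\<^sub>R v \<notin> proj_lattice \<beta>"
    using proj_lattice_first_on_ray[OF p(1,2) _ v(2)] by metis
  define l where "l = S *\<^sub>R v"
  have "l \<noteq> 0" using S(1) \<open>v \<noteq> 0\<close> by (simp add: l_def)
  have fl: "f l = S * f v" "f l > 0"
    using S(1) \<open>f v > 0\<close> by (simp_all add: l_def fnormD(5)[OF f])
  have first: "u *\<^sub>R l \<notin> proj_lattice \<beta>" if "0 < u" "u < 1" for u
    using S(3)[of "u * S"] S(1) that by (simp add: l_def)
  obtain q b where qb: "l = ivec b - of_int q *\<^sub>R \<beta>"
    using S(2) by (auto simp: l_def proj_lattice_def)

  \<comment> \<open>The segment from 0 to \<open>l\<close> is compact, and the remaining lattice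
    points form a closed set disjoint from it by the choice of \<open>S\<close>; their distance
    gives \<open>d\<close>.\<close>
  have "closed (proj_lattice \<beta> - {0, l})"
    using closed_subset_proj_lattice[OF p(1,2)] by blast
  moreover have "compact ((\<lambda>u. u *\<^sub>R l) ` {0..1})"
    by (intro compact_continuous_image continuous_intros) auto
  moreover have "(\<lambda>u. u *\<^sub>R l) ` {0..1} \<inter> (proj_lattice \<beta> - {0, l}) = {}"
  proof -
    have "u *\<^sub>R l \<notin> proj_lattice \<beta> - {0, l}" if "u \<in> {0..1}" for u
      using first[of u] that by (cases "u = 0 \<or> u = 1") auto
    then show ?thesis by blast
  qed
  ultimately obtain d0 where d0: "d0 > 0"
    "\<And>x y. x \<in> (\<lambda>u. u *\<^sub>R l) ` {0..1} \<Longrightarrow> y \<in> proj_lattice \<beta> - {0, l} \<Longrightarrow> d0 \<le> dist x y"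
    by (metis separate_compact_closed)
  define d where "d = \<kappa> * d0"
  have "d > 0" using d0(1) \<kappa>(1) by (simp add: d_def)
  have gap: "d \<le> f (x - u *\<^sub>R l)" if "x \<in> proj_lattice \<beta> - {0, l}" "u \<in> {0..1}" for x u
  proof -
    have "d0 \<le> dist (u *\<^sub>R l) x" using that by (intro d0(2)) blast+
    then have "d0 \<le> norm (x - u *\<^sub>R l)" by (simp add: dist_norm norm_minus_commute)
    then have "d \<le> \<kappa> * norm (x - u *\<^sub>R l)" using \<kappa>(1) by (simp add: d_def)
    then show ?thesis using \<kappa>(2) order_trans by blast
  qed

  define h where "h = g0 + g \<bullet> \<beta>"
  \<comment> \<open>The summands ensure in turn \<open>p < p'\<close>, \<open>\<beta>'\<close>
    inside the cone, \<open>2 p f l < d p'\<close>, and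
    \<open>\<bar>g \<bullet> l\<bar> / p' < \<bar>h\<bar>\<close>. For \<open>h = 0\<close> the last
    one is 0 by the convention on division, and \<open>g \<bullet> v \<noteq> 0\<close> is used
    instead.\<close>
  define B where "B = of_int p + S / r + 2 * of_int p * f l / d + \<bar>g \<bullet> l\<bar> / \<bar>h\<bar>"
  have terms: "S / r \<ge> 0" "2 * of_int p * f l / d \<ge> 0" "\<bar>g \<bullet> l\<bar> / \<bar>h\<bar> \<ge> 0" "real_of_int p \<ge> 1"
    using S(1) pos fl p(1) \<open>d > 0\<close> by simp_all
  \<comment> \<open>\<open>q\<close> may be negative; as \<open>k \<ge> 0\<close> and
    \<open>p \<ge> 1\<close>, still \<open>p' \<ge> q + k > B\<close>.\<close>
  define k where "k = \<lceil>\<bar>B - of_int q\<bar>\<rceil> + 1"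
  define p' where "p' = q + k * p"
  define a' where "a' = b + k *s a"
  define \<beta>' where "\<beta>' = \<beta> + inverse (of_int p') *\<^sub>R l"
  have l: "l = ivec a' - of_int p' *\<^sub>R \<beta>"
  proof -
    have "of_int (k * p) *\<^sub>R \<beta> = of_int k *\<^sub>R ivec a" by (simp flip: p(2))
    then show ?thesis by (simp add: qb a'_def p'_def scaleR_left_distrib)
  qed
  have B: "B < of_int p'"
  proof -
    have "k \<ge> 0" by (simp add: k_def)
    then have "k \<le> k * p" using p(1) by (simp add: mult_le_cancel_left1)
    then have "of_int q + real_of_int k \<le> of_int p'" by (simp add: p'_def flip: of_int_add)
    then show ?thesis unfolding k_def by linarith
  qed
  have "real_of_int p < of_int p'" using B terms unfolding B_def by linarith
  then have "p < p'" by simp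
  define P P' where "P = real_of_int p" "P' = real_of_int p'"
  have P: "1 \<le> P" "P < P'" "1 < P'" using p(1) \<open>p < p'\<close> terms(4) by (auto simp: P_P'_def)
  have \<beta>': "of_int p' *\<^sub>R \<beta>' = ivec a'"
    using P by (simp add: \<beta>'_def l scaleR_add_right P_P'_def)
  have prim: "primitive_point p' a'"
    using primitive_point_mediant[OF p(1) _ p(2,3) l \<open>l \<noteq> 0\<close> first] \<open>p < p'\<close> p(1) by simp

  have "\<beta>' \<in> tip_cone \<beta> \<theta> e r"
    unfolding mem_tip_cone_iff
  proof (intro exI conjI)
    have "S / r < P'" using B terms unfolding B_def P_P'_def by linarith
    then show "S / P' < r" using P pos by (simp add: field_simps)
    show "0 < S / P'" using S(1) P by simp
    show "\<beta>' = \<beta> + (S / P') *\<^sub>R v" by (simp add: \<beta>'_def l_def P_P'_def divide_inverse mult.commute)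
  qed (rule vball)
  moreover have "g0 + g \<bullet> \<beta>' \<noteq> 0"
  proof (cases "h = 0")
    case True
    then have "g \<noteq> 0" using g by (auto simp: h_def)
    moreover have "g0 + g \<bullet> \<beta>' = h + inverse P' * (S * (g \<bullet> v))"
      by (simp add: h_def \<beta>'_def l_def inner_add_right P_P'_def)
    ultimately show ?thesis using True gv S(1) P by simp
  next
    case False
    have "\<bar>g \<bullet> l\<bar> / \<bar>h\<bar> < P'" using B terms unfolding B_def P_P'_def by linarith
    then have "\<bar>g \<bullet> l\<bar> / P' < \<bar>h\<bar>" using P False by (simp add: field_simps)
    moreover have "g0 + g \<bullet> \<beta>' = h + (g \<bullet> l) / P'"
      by (simp add: h_def \<beta>'_def inner_add_right P_P'_def divide_inverse mult.commute)
    moreover have "\<bar>(g \<bullet> l) / P'\<bar> = \<bar>g \<bullet> l\<bar> / P'" using P by simp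
    ultimately show ?thesis by linarith
  qed
  moreover have "open {x. g0 + g \<bullet> x \<noteq> 0}" by (intro open_Collect_neq continuous_intros)
  ultimately obtain \<rho> where \<rho>: "\<rho> > 0" "cball \<beta>' \<rho> \<subseteq> tip_cone \<beta> \<theta> e r \<inter> {x. g0 + g \<bullet> x \<noteq> 0}"
    using open_contains_cball[of "tip_cone \<beta> \<theta> e r \<inter> {x. g0 + g \<bullet> x \<noteq> 0}"] open_tip_cone by blast

  define R where "R = norm \<theta>' + e'"
  have "R > 0" using pos(2) by (simp add: R_def add_nonneg_pos)
  define C where "C = M * R"
  have "C > 0" using M(1) \<open>R > 0\<close> by (simp add: C_def)
  \<comment> \<open>The entries give in turn the two smallness conditions on
    \<open>\<sigma> = s w\<close>, the range \<open>P s / K \<le> t\<close> with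
    \<open>K = P S / P'\<close> needed for the descent, and room inside the ball of radius
    \<open>\<rho>\<close>. \<open>C\<close> bounds \<open>f w\<close>.\<close>
  define r' where "r' = Min {d / (4 * P' * C), P * f l / (2 * P' * P' * C), t * S / P', \<rho> / R}"
  have r': "r' > 0" "r' \<le> d / (4 * P' * C)" "r' \<le> P * f l / (2 * P' * P' * C)" "r' \<le> t * S / P'"
    "r' \<le> \<rho> / R"
    using \<open>C > 0\<close> \<open>R > 0\<close> \<open>d > 0\<close> fl \<rho>(1) pos S(1) P by (simp_all add: r'_def)
  show thesis
  proof (rule that[OF \<open>p < p'\<close> \<beta>' prim r'(1)])
    have "r' * R \<le> \<rho>" using r'(5) \<open>R > 0\<close> by (simp add: field_simps)
    then have "cball \<beta>' (r' * R) \<subseteq> cball \<beta>' \<rho>" by (rule subset_cball)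
    then show "cball \<beta>' (r' * (norm \<theta>' + e')) \<subseteq> tip_cone \<beta> \<theta> e r \<inter> {x. g0 + g \<bullet> x \<noteq> 0}"
      using \<rho>(2) unfolding R_def by (rule subset_trans)
  next
    fix \<alpha> assume "\<alpha> \<in> tip_cone \<beta>' \<theta>' e' r'"
    then obtain s w where s: "0 < s" "s < r'" and w: "w \<in> ball \<theta>' e'" and \<alpha>: "\<alpha> = \<beta>' + s *\<^sub>R w"
      by (auto simp: mem_tip_cone_iff)
    have "norm w \<le> R"
      using w norm_triangle_sub[of w \<theta>'] by (simp add: R_def dist_norm norm_minus_commute)
    then have "M * norm w \<le> C" using M(1) by (simp add: C_def)
    then have "f w \<le> C" using M(2)[of w] by simp
    then have f\<sigma>: "f (s *\<^sub>R w) \<le> s * C" using s by (simp add: fnormD(5)[OF f])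
    have "s < d / (4 * P' * C)" using s r'(2) by simp
    then have "4 * P' * (s * C) < d" using P \<open>C > 0\<close> by (simp add: field_simps)
    then have small1: "4 * P' * f (s *\<^sub>R w) < d"
      using P mult_left_mono[OF f\<sigma>, of "4 * P'"] by linarith
    have "s < P * f l / (2 * P' * P' * C)" using s r'(3) by simp
    then have "2 * P' * (s * C) < P * f l / P'" using P \<open>C > 0\<close> by (simp add: field_simps)
    then have small2: "2 * P' * f (s *\<^sub>R w) < P * f l / P'"
      using P mult_left_mono[OF f\<sigma>, of "2 * P'"] by linarith
    have "2 * P * f l / d < P'" using B terms unfolding B_def P_P'_def by linarith
    then have small3: "2 * P * f l < d * P'" using \<open>d > 0\<close> by (simp add: field_simps)

    \<comment> \<open>Both \<open>\<xi> = K v + P s w\<close> and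
      \<open>\<xi> - \<eta> = K v - (P' - P) s w\<close> lie on one line in direction
      \<open>w\<close>, on opposite sides of \<open>K v\<close>; after division by \<open>K\<close>
      this is the setting of \<open>fnorm_descent_line\<close>.\<close>
    define K where "K = P * S / P'"
    have "K > 0" using P S(1) by (simp add: K_def)
    have \<xi>: "of_int p *\<^sub>R (\<beta>' + s *\<^sub>R w) - ivec a = K *\<^sub>R (v + (P * s / K) *\<^sub>R w)"
      using \<open>K > 0\<close> p(2)
      by (simp add: \<beta>'_def scaleR_add_right P_P'_def l_def) (simp add: K_def P_P'_def divide_inverse mult_ac)
    have \<eta>: "of_int p' *\<^sub>R (\<beta>' + s *\<^sub>R w) - ivec a' = (P' * s) *\<^sub>R w"
      using \<beta>' by (simp add: scaleR_add_right P_P'_def)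
    have \<xi>\<eta>: "K *\<^sub>R (v + (P * s / K) *\<^sub>R w) - (P' * s) *\<^sub>R w = K *\<^sub>R (v - ((P' - P) * s / K) *\<^sub>R w)"
      using \<open>K > 0\<close> by (simp add: scaleR_diff_right scaleR_add_right left_diff_distrib scaleR_diff_left)
    have "s \<le> t * S / P'" using s r'(4) by simp
    then have "P * s \<le> t * K" using P by (simp add: K_def field_simps)
    then have "f (v + (P * s / K) *\<^sub>R w) < f (v - ((P' - P) * s / K) *\<^sub>R w)"
      using \<open>K > 0\<close> P s by (intro fnorm_descent_line[OF f descent[OF vball w]])
        (simp_all add: pos(4) field_simps)
    then have ill: "f (K *\<^sub>R (v + (P * s / K) *\<^sub>R w)) < f (K *\<^sub>R (v - ((P' - P) * s / K) *\<^sub>R w))"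
      using \<open>K > 0\<close> by (simp add: fnormD(5)[OF f])
    show "isolates f \<alpha> p a p'"
      unfolding \<alpha>
    proof (rule isolatesI_near_rational[OF f p(1) \<open>p < p'\<close> p(2,3) \<beta>' l gap])
      show "f (of_int p *\<^sub>R (\<beta>' + s *\<^sub>R w) - ivec a) <
          f (of_int p *\<^sub>R (\<beta>' + s *\<^sub>R w) - ivec a - (of_int p' *\<^sub>R (\<beta>' + s *\<^sub>R w) - ivec a'))"
        unfolding \<xi> \<eta> \<xi>\<eta> by (rule ill)
    qed (use small1 small2 small3 in \<open>simp_all add: P_P'_def\<close>)
  qed
qed

section \<open>From isolation to the sequence of all best approximations\<close>

lemma best_approx_unique_vector:
  assumes "best_approx f \<alpha> p a" "best_approx f \<alpha> p b"
  shows "a = b"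
  using assms unfolding best_approx_def by (metis less_asym)

lemma isolates_imp_best_approx:
  assumes "1 \<le> p" "p < p'" "isolates f \<alpha> p a p'"
  shows "best_approx f \<alpha> p a"
  using assms by (auto simp: best_approx_def isolates_def)

lemma strict_mono_int_bracket:
  fixes P :: "nat \<Rightarrow> int"
  assumes "strict_mono P" "P 0 \<le> q"
  obtains n where "P n \<le> q" "q < P (Suc n)"
proof -
  have "P 0 + int n \<le> P n" for n
  proof (induction n)
    case (Suc n)
    have "P n < P (Suc n)" using assms(1) by (simp add: strict_mono_Suc_iff)
    then show ?case using Suc by simp
  qed simp
  from this[of "nat (q - P 0) + 1"] have ex: "q < P (nat (q - P 0) + 1)" using assms(2) by simp
  obtain n where n: "q < P n" "\<And>m. m < n \<Longrightarrow> \<not> q < P m"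
    using exists_least_iff[of "\<lambda>n. q < P n"] ex by blast
  have "n \<noteq> 0" using n(1) assms(2) by (metis not_less)
  then show thesis using that[of "n - 1"] n(1) n(2)[of "n - 1"] by simp
qed

text \<open>As \<open>P 0 = 1\<close>, any best approximation \<open>(q, b)\<close> has
  \<open>P n \<le> q < P (Suc n)\<close> for some \<open>n\<close>. If it differed from
  \<open>(P n, A n)\<close>, isolation would make its error larger, which forces
  \<open>q = P n\<close> and then \<open>b = A n\<close>.\<close>

lemma best_approx_seqI:
  assumes mono: "strict_mono P" and "P 0 = 1"
    and iso: "\<And>n. isolates f \<alpha> (P n) (A n) (P (Suc n))"
  shows "best_approx_seq f \<alpha> P A"
proof -
  have P: "1 \<le> P n" "P n < P (Suc n)" for n
    using mono assms(2) by (metis le0 strict_mono_less_eq) (use mono in \<open>simp add: strict_mono_Suc_iff\<close>)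
  have best: "best_approx f \<alpha> (P n) (A n)" for n
    using isolates_imp_best_approx P iso by blast
  moreover have "\<exists>n. P n = q \<and> A n = b" if b: "best_approx f \<alpha> q b" for q b
  proof -
    have q: "1 \<le> q" using b by (simp add: best_approx_def)
    then obtain n where n: "P n \<le> q" "q < P (Suc n)"
      using strict_mono_int_bracket[OF mono] assms(2) by metis
    have "(q, b) = (P n, A n)"
    proof (rule ccontr)
      assume "(q, b) \<noteq> (P n, A n)"
      then have "f (of_int (P n) *\<^sub>R \<alpha> - ivec (A n)) < f (of_int q *\<^sub>R \<alpha> - ivec b)"
        using iso n q by (auto simp: isolates_def)
      moreover have "f (of_int q *\<^sub>R \<alpha> - ivec b) < f (of_int (P n) *\<^sub>R \<alpha> - ivec (A n))"
        if "P n \<noteq> q"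
        using that b n(1) P(1)[of n] by (simp add: best_approx_def)
      ultimately have "P n = q" by force
      then have "A n = b" using best[of n] b best_approx_unique_vector by blast
      then show False using \<open>(q, b) \<noteq> (P n, A n)\<close> \<open>P n = q\<close> by simp
    qed
    then show ?thesis by auto
  qed
  ultimately show ?thesis using mono by (auto simp: best_approx_seq_def)
qed

lemma strict_mono_range_unique:
  fixes P Q :: "nat \<Rightarrow> 'a::linorder"
  assumes "strict_mono P" "strict_mono Q" "range P = range Q"
  shows "P = Q"
proof
  have le: "P n \<le> Q n" if P: "strict_mono P" and Q: "strict_mono Q" "range Q \<subseteq> range P"
    and eq: "\<And>m. m < n \<Longrightarrow> P m = Q m" for P Q :: "nat \<Rightarrow> 'a" and n
  proof -
    obtain k where k: "Q n = P k" using Q(2) by blast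
    have "\<not> k < n" using Q(1) eq k by (metis less_irrefl strict_mono_less)
    then show ?thesis using P k by (simp add: strict_mono_less_eq)
  qed
  fix n show "P n = Q n"
  proof (induction n rule: less_induct)
    case (less n)
    then show ?case using le[of P Q n] le[of Q P n] assms by (simp add: order_antisym)
  qed
qed

text \<open>This carries the limit from the constructed sequence over to every sequence of best
  approximations.\<close>

lemma best_approx_seq_unique:
  assumes "best_approx_seq f \<alpha> P A" "best_approx_seq f \<alpha> Q B"
  shows "P = Q" "A = B"
proof -
  have "range P = {p. \<exists>a. best_approx f \<alpha> p a}" if "best_approx_seq f \<alpha> P A" for P A
  proof -
    have "best_approx f \<alpha> (P n) (A n)" "best_approx f \<alpha> p a \<Longrightarrow> \<exists>n. p = P n" for n p a
      using that unfolding best_approx_seq_def by metis+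
    then show ?thesis by (auto simp: image_iff)
  qed
  then have "range P = range Q" using assms by metis
  then show "P = Q" using assms by (intro strict_mono_range_unique) (auto simp: best_approx_seq_def)
  then have "best_approx f \<alpha> (P n) (A n)" "best_approx f \<alpha> (P n) (B n)" for n
    using assms by (simp_all add: best_approx_seq_def)
  then show "A = B" using best_approx_unique_vector by blast
qed

section \<open>Convergence of directions, rational independence and the limit point\<close>

text \<open>Since \<open>f \<theta> = 1\<close>, the value \<open>f w\<close> differs from 1 by at
  most \<open>M * norm (w - \<theta>)\<close>, and dividing by \<open>f w\<close> moves
  \<open>w\<close> by at most that amount over \<open>\<kappa>\<close>.\<close>

lemma fnorm_normalize_close:
  assumes f: "is_fnorm f" and M: "\<And>x. f x \<le> M * norm x" and \<kappa>: "\<kappa> > 0" "\<And>x. \<kappa> * norm x \<le> f x"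
    and \<theta>: "f \<theta> = 1" and w: "w \<noteq> 0"
  shows "norm (inverse (f w) *\<^sub>R w - \<theta>) \<le> (M / \<kappa> + 1) * norm (w - \<theta>)"
proof -
  have fw: "f w > 0" using fnormD(6)[OF f w] .
  have "\<bar>1 - f w\<bar> \<le> f (w - \<theta>)"
    using fnorm_triangle_lower(2)[OF f, of w \<theta>] fnorm_triangle_lower(2)[OF f, of \<theta> w]
      fnormD(4)[OF f, of w \<theta>] \<theta> by linarith
  then have 1: "\<bar>1 - f w\<bar> \<le> M * norm (w - \<theta>)" using M order_trans by blast
  have "inverse (f w) *\<^sub>R w - w = ((1 - f w) / f w) *\<^sub>R w"
    using fw by (simp add: divide_inverse left_diff_distrib scaleR_diff_left)
  then have "norm (inverse (f w) *\<^sub>R w - w) = \<bar>1 - f w\<bar> * (norm w / f w)" using fw by simp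
  also have "\<dots> \<le> (M * norm (w - \<theta>)) * (1 / \<kappa>)"
    using 1 fw \<kappa>(1) \<kappa>(2)[of w] by (intro mult_mono) (auto simp: field_simps)
  finally show ?thesis
    using norm_triangle_ineq[of "inverse (f w) *\<^sub>R w - w" "w - \<theta>"] by (simp add: algebra_simps)
qed

text \<open>Packing the coefficients into one pair lets all rational relations be enumerated as a
  single countable set.\<close>

lemma Q_lin_indep1I:
  assumes "\<And>c. fst c \<noteq> 0 \<or> snd c \<noteq> (\<lambda>_. 0) \<Longrightarrow>
    of_rat (fst c) + (\<chi> i. of_rat (snd c i)) \<bullet> \<alpha> \<noteq> 0"
  shows "Q_lin_indep1 \<alpha>"
  unfolding Q_lin_indep1_def
proof (intro allI impI)
  fix c0 :: rat and c :: "'a \<Rightarrow> rat"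
  assume "of_rat c0 + (\<Sum>i\<in>UNIV. of_rat (c i) * \<alpha> $ i) = 0"
  then show "c0 = 0 \<and> (\<forall>i. c i = 0)"
    using assms[of "(c0, c)"] by (auto simp: inner_vec_def fun_eq_iff)
qed

theorem theorem2p6:
  fixes f :: "real^'n \<Rightarrow> real" and \<theta> :: "nat \<Rightarrow> real^'n"
  assumes "is_fnorm f"
    and "\<And>\<nu>. \<theta> \<nu> \<in> fball f 0"
    and "\<And>\<nu>. illuminated (fball f (\<theta> \<nu>)) 0 (\<theta> (Suc \<nu>))"
  shows "\<exists>\<alpha>::real^'n. Q_lin_indep1 \<alpha>
     \<and> (\<exists>P A. best_approx_seq f \<alpha> P A)
     \<and> (\<forall>P A. best_approx_seq f \<alpha> P A \<longrightarrow>
          (\<lambda>\<nu>. norm ((inverse (f (of_int (P \<nu>) *\<^sub>R \<alpha> - ivec (A \<nu>))))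
                      *\<^sub>R (of_int (P \<nu>) *\<^sub>R \<alpha> - ivec (A \<nu>)) - \<theta> \<nu>)) \<longlonglongrightarrow> 0)"
proof -
  note f = assms(1)
  have unit: "f (\<theta> n) = 1" for n using illuminated_fballD(1)[OF f assms(3)] .
  have "\<exists>t d. t > 0 \<and> d > 0 \<and>
    (\<forall>v \<in> ball (\<theta> n) d. \<forall>w \<in> ball (\<theta> (Suc n)) d. f (v + t *\<^sub>R w) < f v)" for n
    using illuminated_fballD(2)[OF f assms(3)[of n]] fnorm_descent_nhds[OF f] by metis
  then obtain t d where t: "\<And>n. t n > (0::real)" and d: "\<And>n. d n > (0::real)"
    and td: "\<And>n v w. v \<in> ball (\<theta> n) (d n) \<Longrightarrow> w \<in> ball (\<theta> (Suc n)) (d n) \<Longrightarrow> f (v + t n *\<^sub>R w) < f v"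
    by metis
  \<comment> \<open>\<open>\<theta> n\<close> is the centre for \<open>v\<close> at index
    \<open>n\<close> and for \<open>w\<close> at index \<open>n - 1\<close>, hence two radii; at 0
    both are \<open>d 0\<close>. The bound \<open>1 / real (Suc n)\<close> forces the directions to
    approach \<open>\<theta> n\<close>.\<close>
  define e where "e n = min (min (d n) (d (n - 1))) (1 / real (Suc n))" for n
  have e: "e n > 0" "e n \<le> 1 / real (Suc n)" for n using d by (simp_all add: e_def)
  have descent: "f (v + t n *\<^sub>R w) < f v"
    if "v \<in> ball (\<theta> n) (e n)" "w \<in> ball (\<theta> (Suc n)) (e (Suc n))" for n v w
    using that by (intro td) (auto simp: e_def)

  define cs where "cs = {c :: rat \<times> ('n \<Rightarrow> rat). fst c \<noteq> 0 \<or> snd c \<noteq> (\<lambda>_. 0)}"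
  have "(1, \<lambda>_. 0) \<in> cs" by (simp add: cs_def)
  then have cs: "cs \<noteq> {}" "countable cs" by auto
  define g0 :: "nat \<Rightarrow> real" where "g0 n = of_rat (fst (from_nat_into cs n))" for n
  define g :: "nat \<Rightarrow> real^'n" where "g n = (\<chi> i. of_rat (snd (from_nat_into cs n) i))" for n
  have g: "g0 n \<noteq> 0 \<or> g n \<noteq> 0" for n
    using from_nat_into[OF cs(1), of n] by (auto simp: cs_def g0_def g_def vec_eq_iff fun_eq_iff)

  define bound where "bound n \<beta> r = cball \<beta> (r * (norm (\<theta> n) + e n))" for n and \<beta> :: "real^'n" and r
  define C where "C n \<beta> r = tip_cone \<beta> (\<theta> n) (e n) r" for n \<beta> r
  \<comment> \<open>Starting with denominator 1 leaves no positive denominator before the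
    sequence.\<close>
  define I :: "nat \<Rightarrow> int \<times> (int^'n) \<times> (real^'n) \<times> real \<Rightarrow> bool" where "I = (\<lambda>n (p, a, \<beta>, r). 1 \<le> p \<and> of_int p *\<^sub>R \<beta> = ivec a \<and> primitive_point p a \<and> 0 < r
    \<and> (n = 0 \<longrightarrow> p = 1))"
  define Step :: "nat \<Rightarrow> int \<times> (int^'n) \<times> (real^'n) \<times> real \<Rightarrow> int \<times> (int^'n) \<times> (real^'n) \<times> real \<Rightarrow> bool"
    where "Step = (\<lambda>n (p, a, \<beta>, r) (p', a', \<beta>', r'). p < p' \<and>
    bound (Suc n) \<beta>' r' \<subseteq> C n \<beta> r \<inter> {x. g0 n + g n \<bullet> x \<noteq> 0} \<and>
    (\<forall>\<alpha> \<in> C (Suc n) \<beta>' r'. isolates f \<alpha> p a p'))"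
  have "\<exists>X. \<forall>n. I n (X n) \<and> Step n (X n) (X (Suc n))"
  proof (rule dependent_nat_choice)
    have "I 0 (1, 0, 0, 1)" by (simp add: I_def primitive_point_def)
    then show "\<exists>x. I 0 x" ..
  next
    fix x n assume "I n x"
    moreover obtain p a \<beta> r where x: "x = (p, a, \<beta>, r)" by (cases x) auto
    ultimately have inv: "1 \<le> p" "of_int p *\<^sub>R \<beta> = ivec a" "primitive_point p a" "0 < r"
      by (auto simp: I_def)
    obtain p' a' r' \<beta>' where "p < p'" "of_int p' *\<^sub>R \<beta>' = ivec a'" "primitive_point p' a'" "r' > 0"
      "bound (Suc n) \<beta>' r' \<subseteq> C n \<beta> r \<inter> {x. g0 n + g n \<bullet> x \<noteq> 0}"
      "\<And>\<alpha>. \<alpha> \<in> C (Suc n) \<beta>' r' \<Longrightarrow> isolates f \<alpha> p a p'"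
      by (rule tip_cone_refine[where \<theta> = "\<theta> n" and \<theta>' = "\<theta> (Suc n)",
            OF f inv(1-3) e(1)[of n] e(1)[of "Suc n"] inv(4) t[of n] _ g[of n],
            folded bound_def C_def])
        (erule (1) descent, blast intro: that)
    then have "I (Suc n) (p', a', \<beta>', r') \<and> Step n x (p', a', \<beta>', r')"
      using inv(1) by (simp add: I_def Step_def x)
    then show "\<exists>y. I (Suc n) y \<and> Step n x y" ..
  qed
  then obtain X where X: "\<And>n. I n (X n)" "\<And>n. Step n (X n) (X (Suc n))" by blast
  define p a \<beta> r where "p n = fst (X n)" "a n = fst (snd (X n))" "\<beta> n = fst (snd (snd (X n)))"
    "r n = snd (snd (snd (X n)))" for n
  have X_eq: "X n = (p n, a n, \<beta> n, r n)" for n by (simp add: p_a_\<beta>_r_def)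
  have p: "1 \<le> p n" "of_int (p n) *\<^sub>R \<beta> n = ivec (a n)" "0 < r n" "p 0 = 1" for n
    using X(1)[of n] X(1)[of 0] by (auto simp: I_def X_eq)
  have step: "p n < p (Suc n)"
    "bound (Suc n) (\<beta> (Suc n)) (r (Suc n)) \<subseteq> C n (\<beta> n) (r n) \<inter> {x. g0 n + g n \<bullet> x \<noteq> 0}"
    "\<And>\<alpha>. \<alpha> \<in> C (Suc n) (\<beta> (Suc n)) (r (Suc n)) \<Longrightarrow> isolates f \<alpha> (p n) (a n) (p (Suc n))" for n
    using X(2)[of n] by (auto simp: Step_def X_eq)

  define K where "K n = bound n (\<beta> n) (r n)" for n
  have "C n (\<beta> n) (r n) \<subseteq> K n" for n
    unfolding C_def K_def bound_def by (rule tip_cone_subset_cball)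
  then have "K (Suc n) \<subseteq> K n" for n
    using step(2)[of n] by (auto simp: K_def)
  then have "K n \<subseteq> K m" if "m \<le> n" for m n
    using lift_Suc_antimono_le[of K m n] that by blast
  moreover have "compact (K n)" for n by (simp add: K_def bound_def)
  moreover have "K n \<noteq> {}" for n
    using p(3)[of n] e(1)[of n] by (simp add: K_def bound_def not_less add_nonneg_nonneg)
  ultimately have "\<Inter>(range K) \<noteq> {}" by (intro compact_nest) auto
  \<comment> \<open>As \<open>K (Suc n)\<close> lies inside the open cone of stage \<open>n\<close>
    and off the \<open>n\<close>-th hyperplane, \<open>\<alpha>\<close> belongs to every cone and
    avoids every hyperplane.\<close>
  then obtain \<alpha> where "\<And>n. \<alpha> \<in> K n" by auto
  then have \<alpha>: "\<alpha> \<in> C n (\<beta> n) (r n)" "g0 n + g n \<bullet> \<alpha> \<noteq> 0" for n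
    using step(2)[of n] by (auto simp: K_def)

  have "Q_lin_indep1 \<alpha>"
  proof (rule Q_lin_indep1I)
    fix c :: "rat \<times> ('n \<Rightarrow> rat)"
    assume "fst c \<noteq> 0 \<or> snd c \<noteq> (\<lambda>_. 0)"
    then obtain n where "from_nat_into cs n = c"
      using from_nat_into_surj[OF cs(2), of c] by (auto simp: cs_def)
    then show "of_rat (fst c) + (\<chi> i. of_rat (snd c i)) \<bullet> \<alpha> \<noteq> 0"
      using \<alpha>(2)[of n] by (simp add: g0_def g_def)
  qed
  moreover have seq: "best_approx_seq f \<alpha> p a"
    using best_approx_seqI[of p f \<alpha> a] step(1,3) \<alpha>(1) p(4) by (simp add: strict_mono_Suc_iff)
  moreover have "(\<lambda>n. norm (inverse (f (of_int (p n) *\<^sub>R \<alpha> - ivec (a n))) *\<^sub>R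
      (of_int (p n) *\<^sub>R \<alpha> - ivec (a n)) - \<theta> n)) \<longlonglongrightarrow> 0"
  proof -
    obtain M where M: "M > 0" "\<And>x. f x \<le> M * norm x" using fnorm_bounded_above[OF f] by blast
    obtain \<kappa> where \<kappa>: "\<kappa> > 0" "\<And>x. \<kappa> * norm x \<le> f x" using fnorm_bounded_below[OF f] by blast
    have "norm (inverse (f (of_int (p n) *\<^sub>R \<alpha> - ivec (a n))) *\<^sub>R
      (of_int (p n) *\<^sub>R \<alpha> - ivec (a n)) - \<theta> n) \<le> (M / \<kappa> + 1) * (1 / real (Suc n))" for n
    proof -
      obtain s w where s: "0 < s" and w: "w \<in> ball (\<theta> n) (e n)" and eq: "\<alpha> = \<beta> n + s *\<^sub>R w"
        using \<alpha>(1)[of n] by (auto simp: C_def mem_tip_cone_iff)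
      have "f (w + t n *\<^sub>R \<theta> (Suc n)) < f w" using w e(1) by (intro descent) auto
      then have "w \<noteq> 0"
        using fnormD(1)[OF f, of "w + t n *\<^sub>R \<theta> (Suc n)"] fnormD(2)[OF f, of w] by auto
      \<comment> \<open>The error is a positive multiple of \<open>w\<close>, and normalising by
        \<open>f\<close> removes the factor.\<close>
      have \<xi>: "of_int (p n) *\<^sub>R \<alpha> - ivec (a n) = (of_int (p n) * s) *\<^sub>R w"
        by (simp add: eq scaleR_add_right p(2))
      have "real_of_int (p n) > 0" using p(1)[of n] by simp
      then have "inverse (f (of_int (p n) *\<^sub>R \<alpha> - ivec (a n))) *\<^sub>R (of_int (p n) *\<^sub>R \<alpha> - ivec (a n))
          = inverse (f w) *\<^sub>R w"
        using s unfolding \<xi> by (simp add: fnormD(5)[OF f] field_simps)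
      moreover have "norm (inverse (f w) *\<^sub>R w - \<theta> n) \<le> (M / \<kappa> + 1) * norm (w - \<theta> n)"
        using fnorm_normalize_close[OF f M(2) \<kappa> unit \<open>w \<noteq> 0\<close>] .
      moreover have "norm (w - \<theta> n) \<le> 1 / real (Suc n)"
        using w e(2)[of n] by (simp add: dist_norm norm_minus_commute)
      then have "(M / \<kappa> + 1) * norm (w - \<theta> n) \<le> (M / \<kappa> + 1) * (1 / real (Suc n))"
        using M(1) \<kappa>(1) by (intro mult_left_mono) auto
      ultimately show ?thesis by simp
    qed
    note bound = this
    have lim: "(\<lambda>n. (M / \<kappa> + 1) * (1 / real (Suc n))) \<longlonglongrightarrow> 0"
      using tendsto_mult_right_zero[OF LIMSEQ_inverse_real_of_nat] by (simp only: inverse_eq_divide)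
    show ?thesis
      by (rule tendsto_sandwich[OF always_eventually always_eventually tendsto_const lim])
        (intro allI norm_ge_zero bound)+
  qed
  ultimately show ?thesis
    using best_approx_seq_unique[OF seq] by blast
qed

end
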